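(* Let $n\ge 2$, let $\bar A$ be an $n\times n$ real matrix for which $\|\bar A\|_2\le 1$, and let $A$ be a Gaussian perturbation of $\bar A$ of variance $\sigma^2\le 1$ (with $\sigma>0$). Then for every $x>0$, $$\Pr\left[\rho_L(A)>x\right]\le \sqrt{\frac2\pi}\,\frac{n^2}{x}\left(\frac{\sqrt2}{\sigma}+\sqrt{2\ln n}+\frac{1}{\sqrt{2\pi}\,\ln n}\right).$$
   Context: $\|\cdot\|_2$ is the operator norm induced by the Euclidean norm; $\|\cdot\|_\infty$ of a matrix is the maximum absolute row sum. $A$ is a Gaussian perturbation of $\bar A$ of variance $\sigma^2$ if $A=\bar A+G$ where the entries of $G$ are independent Gaussian random variables with mean $0$ and standard deviation $\sigma$. With probability 1, $A$ has a unique LU-factorization (without pivoting) $A=LU$, where $L$ is lower-triangular with $1$s on the diagonal and $U$ is upper-triangular. The growth factor is $\rho_L(A)=\|L\|_\infty$. *)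

theory Defs
  imports "HOL-Probability.Probability"
begin

text \<open>An \<open>n \<times> n\<close> matrix has type \<open>'n sq_matrix\<close> with \<open>n = CARD('n)\<close>. The order on the index
  type that triangularity needs comes from the class \<^class>\<open>wellorder\<close>, as in the library's results
  on determinants of triangular matrices; a finite well-order of size \<open>n\<close> is just
  \<open>{1 < \<dots> < n}\<close>.\<close>

type_synonym 'n sq_matrix = "real^'n^'n"

definition max_row_sum :: "real^'m^'n \<Rightarrow> real" where
  "max_row_sum A = (MAX i. \<Sum>j\<in>UNIV. \<bar>A $ i $ j\<bar>)"

definition unit_lower_triangular :: "'n::{finite,wellorder} sq_matrix \<Rightarrow> bool" where
  "unit_lower_triangular L \<longleftrightarrow> (\<forall>i j. i < j \<longrightarrow> L $ i $ j = 0) \<and> (\<forall>i. L $ i $ i = 1)"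

definition upper_triangular :: "'n::{finite,wellorder} sq_matrix \<Rightarrow> bool" where
  "upper_triangular U \<longleftrightarrow> (\<forall>i j. j < i \<longrightarrow> U $ i $ j = 0)"

definition LU_factorization ::
  "'n::{finite,wellorder} sq_matrix \<Rightarrow> 'n sq_matrix \<Rightarrow> 'n sq_matrix \<Rightarrow> bool" where
  "LU_factorization A L U \<longleftrightarrow> unit_lower_triangular L \<and> upper_triangular U \<and> A = L ** U"

text \<open>The growth factor is only meaningful if the factorization exists and is unique, which for
  Gaussian perturbations is almost sure. Elsewhere it is set to \<open>\<infinity>\<close>, so that no upper tail bound
  can profit from the exceptional matrices: these belong to every event \<open>\<rho>\<^sub>L(A) > x\<close>.\<close>

definition growth_factor_L :: "'n::{finite,wellorder} sq_matrix \<Rightarrow> ereal" where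
  "growth_factor_L A =
     (if \<exists>!LU. LU_factorization A (fst LU) (snd LU)
      then ereal (max_row_sum (THE L. \<exists>U. LU_factorization A L U))
      else \<infinity>)"

text \<open>\<open>\<sigma>\<close> is the standard deviation, not the variance.\<close>

definition gaussian_perturbation ::
  "'w measure \<Rightarrow> real \<Rightarrow> real^'m^'n \<Rightarrow> ('w \<Rightarrow> real^'m^'n) \<Rightarrow> bool" where
  "gaussian_perturbation M \<sigma> Abar A \<longleftrightarrow>
     (\<exists>G. (\<forall>\<omega>\<in>space M. A \<omega> = Abar + G \<omega>) \<and>
          prob_space.indep_vars M (\<lambda>_. borel) (\<lambda>(i, j) \<omega>. G \<omega> $ i $ j) UNIV \<and>
          (\<forall>i j. distributed M lborel (\<lambda>\<omega>. G \<omega> $ i $ j) (normal_density 0 \<sigma>)))"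

text \<open>The events \<open>\<rho>\<^sub>L(A) > x\<close> are measurable, hence their \<^const>\<open>measure\<close> is a genuine probability.\<close>

lemma borel_image_closed_UN:
  fixes f :: "'a::euclidean_space \<Rightarrow> 'b::euclidean_space"
  assumes f: "continuous_on UNIV f" and C: "\<And>k::nat. closed (C k)"
  shows "f ` (\<Union>k. C k) \<in> sets borel"
proof -
  have "f ` (\<Union>k. C k) = (\<Union>k. \<Union>m::nat. f ` (C k \<inter> cball 0 (real m)))"
    using real_arch_simple by (fastforce simp: image_iff)
  moreover have "closed (f ` (C k \<inter> cball 0 (real m)))" for k m
    by (intro compact_imp_closed compact_continuous_image continuous_on_subset[OF f]
        closed_Int_compact[OF C compact_cball]) simp
  ultimately show ?thesis
    by (auto intro!: sets.countable_UN borel_closed)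
qed

lemma max_row_sum_gt_iff: "x < max_row_sum A \<longleftrightarrow> (\<exists>i. x < (\<Sum>j\<in>UNIV. \<bar>A $ i $ j\<bar>))"
  unfolding max_row_sum_def by (subst Max_gr_iff) auto

lemma growth_factor_L_gt_iff:
  fixes A :: "'n::{finite,wellorder} sq_matrix"
  shows "ereal x < growth_factor_L A \<longleftrightarrow>
    (\<forall>L U. \<not> LU_factorization A L U) \<or>
    (\<exists>L U L' U'. LU_factorization A L U \<and> LU_factorization A L' U' \<and> (L, U) \<noteq> (L', U')) \<or>
    (\<exists>L U. LU_factorization A L U \<and> x < max_row_sum L)"
proof (cases "\<exists>!LU. LU_factorization A (fst LU) (snd LU)")
  case True
  then obtain L U where LU: "LU_factorization A L U"
    and uniq: "\<And>L' U'. LU_factorization A L' U' \<Longrightarrow> L' = L \<and> U' = U"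
    by (metis fst_conv snd_conv)
  have "(THE L. \<exists>U. LU_factorization A L U) = L"
    using LU uniq by blast
  then have "growth_factor_L A = ereal (max_row_sum L)"
    unfolding growth_factor_L_def if_P[OF True] by simp
  then have "ereal x < growth_factor_L A \<longleftrightarrow> x < max_row_sum L"
    by simp
  then show ?thesis
    using LU uniq by metis
next
  case False
  then have "ereal x < growth_factor_L A"
    unfolding growth_factor_L_def if_not_P[OF False] by simp
  moreover have "(\<forall>L U. \<not> LU_factorization A L U) \<or>
    (\<exists>L U L' U'. LU_factorization A L U \<and> LU_factorization A L' U' \<and> (L, U) \<noteq> (L', U'))"
    using False by (metis prod.collapse fst_conv snd_conv)
  ultimately show ?thesis by blast
qed

lemma growth_factor_L_borel:
  "{A :: 'n::{finite,wellorder} sq_matrix. ereal x < growth_factor_L A} \<in> sets borel"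
proof -
  let ?T = "{(L :: 'n sq_matrix, U :: 'n sq_matrix). unit_lower_triangular L \<and> upper_triangular U}"
  let ?f = "\<lambda>(L :: 'n sq_matrix, U :: 'n sq_matrix). L ** U"
  have cont: "continuous_on UNIV ?f"
    unfolding matrix_matrix_mult_def split_def by (intro continuous_intros)
  have cont': "continuous_on UNIV (?f \<circ> fst)" "continuous_on UNIV (?f \<circ> snd)"
    by (intro continuous_on_compose continuous_intros continuous_on_subset[OF cont]; simp)+
  have T: "closed ?T"
    unfolding unit_lower_triangular_def upper_triangular_def split_def
    by (intro closed_Collect_conj closed_Collect_all closed_Collect_imp closed_Collect_eq
        continuous_intros open_Collect_const)
  define C2 where "C2 k = (?T \<times> ?T) \<inter> {p. ?f (fst p) = ?f (snd p)} \<inter>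
      {p. 1 / (real k + 1) \<le> dist (fst p) (snd p)}" for k :: nat
  define C3 where "C3 i k = ?T \<inter> {p. x + 1 / (real k + 1) \<le> (\<Sum>j\<in>UNIV. \<bar>fst p $ i $ j\<bar>)}"
    for i and k :: nat
  have "closed (C2 k)" for k
    unfolding C2_def using cont'
    by (intro closed_Int closed_Times T closed_Collect_eq closed_Collect_le continuous_intros)
      (auto simp: o_def)
  moreover have "closed (C3 i k)" for i k
    unfolding C3_def by (intro closed_Int T closed_Collect_le continuous_intros)
  ultimately have B: "?f ` (\<Union>k::nat. ?T) \<in> sets borel" "(?f \<circ> fst) ` (\<Union>k. C2 k) \<in> sets borel"
      "(\<Union>i. ?f ` (\<Union>k. C3 i k)) \<in> sets borel"
    using T by (intro borel_image_closed_UN cont cont' sets.finite_UN; simp)+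
  have arch: "0 < d \<longleftrightarrow> (\<exists>k::nat. 1 / (real k + 1) \<le> d)" for d :: real
  proof
    assume "0 < d"
    then obtain k where "1 / real (Suc k) < d" using nat_approx_posE by metis
    then show "\<exists>k::nat. 1 / (real k + 1) \<le> d" by (intro exI[of _ k]) (simp add: add.commute)
  next
    assume "\<exists>k::nat. 1 / (real k + 1) \<le> d"
    then obtain k :: nat where "1 / (real k + 1) \<le> d" ..
    moreover have "0 < 1 / (real k + 1)" by simp
    ultimately show "0 < d" by linarith
  qed
  have C2: "(\<Union>k. C2 k) = {p \<in> ?T \<times> ?T. ?f (fst p) = ?f (snd p) \<and> fst p \<noteq> snd p}"
    unfolding C2_def using arch by (auto simp flip: zero_less_dist_iff)
  have C3: "(\<Union>k. C3 i k) = {p \<in> ?T. x < (\<Sum>j\<in>UNIV. \<bar>fst p $ i $ j\<bar>)}" for i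
    unfolding C3_def
    using arch[of "(\<Sum>j\<in>UNIV. \<bar>fst p $ i $ j\<bar>) - x" for p] by (fastforce simp: algebra_simps)
  have "{A :: 'n sq_matrix. ereal x < growth_factor_L A} =
      - (?f ` (\<Union>k::nat. ?T)) \<union> (?f \<circ> fst) ` (\<Union>k. C2 k) \<union> (\<Union>i. ?f ` (\<Union>k. C3 i k))"
    (is "?E = - ?X \<union> ?Y \<union> ?Z")
  proof -
    have X: "A \<in> ?X \<longleftrightarrow> (\<exists>L U. LU_factorization A L U)" for A
      by (auto simp: LU_factorization_def image_iff)
    have Y: "A \<in> ?Y \<longleftrightarrow> (\<exists>L U L' U'. LU_factorization A L U \<and>
        LU_factorization A L' U' \<and> (L, U) \<noteq> (L', U'))" for A
    proof
      assume "A \<in> ?Y"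
      then obtain L U L' U' where "(L, U) \<in> ?T" "(L', U') \<in> ?T" "A = L ** U" "L ** U = L' ** U'"
          "(L, U) \<noteq> (L', U')"
        unfolding C2 by force
      then have "LU_factorization A L U" "LU_factorization A L' U'"
        by (auto simp: LU_factorization_def)
      then show "\<exists>L U L' U'. LU_factorization A L U \<and> LU_factorization A L' U' \<and> (L, U) \<noteq> (L', U')"
        using \<open>(L, U) \<noteq> (L', U')\<close> by metis
    next
      assume "\<exists>L U L' U'. LU_factorization A L U \<and> LU_factorization A L' U' \<and> (L, U) \<noteq> (L', U')"
      then obtain L U L' U' where "LU_factorization A L U" "LU_factorization A L' U'"
          "(L, U) \<noteq> (L', U')" by metis
      then show "A \<in> ?Y"
        unfolding C2 by (intro image_eqI[of _ _ "((L, U), (L', U'))"]) (auto simp: LU_factorization_def)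
    qed
    have Z: "A \<in> ?Z \<longleftrightarrow> (\<exists>L U. LU_factorization A L U \<and> x < max_row_sum L)" for A
    proof
      assume "A \<in> ?Z"
      then obtain i L U where "(L, U) \<in> ?T" "x < (\<Sum>j\<in>UNIV. \<bar>L $ i $ j\<bar>)" "A = L ** U"
        unfolding C3 by force
      then have "LU_factorization A L U" "x < max_row_sum L"
        by (auto simp: LU_factorization_def max_row_sum_gt_iff)
      then show "\<exists>L U. LU_factorization A L U \<and> x < max_row_sum L" by metis
    next
      assume "\<exists>L U. LU_factorization A L U \<and> x < max_row_sum L"
      then obtain i L U where "LU_factorization A L U" "x < (\<Sum>j\<in>UNIV. \<bar>L $ i $ j\<bar>)"
        unfolding max_row_sum_gt_iff by metis
      then show "A \<in> ?Z"
        unfolding C3 by (intro UN_I[of i] image_eqI[of _ _ "(L, U)"]) (auto simp: LU_factorization_def)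
    qed
    show ?thesis
      by (intro set_eqI) (simp only: mem_Collect_eq Un_iff Compl_iff X Y Z growth_factor_L_gt_iff
          not_ex disj_assoc)
  qed
  then show ?thesis by (simp only:) (intro sets.Un borel_comp B)
qed

end

(* Let a_i be the rows of A and let w^k be the vector of cofactors of row k in the leading k x k
   block of A, extended by zeros. It depends only on the rows before k, is orthogonal to them, and
   is supported on the first k coordinates, so that L_ik = (a_i . w^k) / (a_k . w^k). After
   normalising w^k to a unit vector u, the denominator is, given the other rows, a Gaussian of
   standard deviation sigma, and a small-ball estimate gives
   Pr[max_{i>k} |L_ik| > y] <= sqrt(2/pi) / (sigma y) * E[max_{i>k} |a_i . u|].
   Each a_i . u with i > k is in turn a Gaussian with mean at most 1 in absolute value, so the last
   expectation is at most 1 + sigma (sqrt(2 ln n) + 1 / (sqrt(2 pi) ln n)). Taking y = x / n and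
   summing over k gives the bound. The numerator bound used for the maximum is strictly positive,
   so the same event also covers vanishing pivots. *)

theory Submission
  imports Defs "HOL-Real_Asymp.Real_Asymp"
begin

section \<open>Elimination vectors and LU factorizations\<close>

text \<open>Identity rows after \<open>k\<close> make the determinant that of the leading block
  through \<open>k\<close>, with \<open>v\<close> cut to that block as its last row. Leading minors
  thus need no smaller matrix type.\<close>

definition elimination_matrix ::
  "'n::{finite,wellorder} sq_matrix \<Rightarrow> 'n \<Rightarrow> real^'n::{finite,wellorder} \<Rightarrow> 'n sq_matrix" where
  "elimination_matrix A k v = (\<chi> i. if i < k then A $ i else if i = k then v else axis i 1)"

definition elimination_vector :: "'n::{finite,wellorder} sq_matrix \<Rightarrow> 'n \<Rightarrow> real^'n::{finite,wellorder}" where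
  "elimination_vector A k = (\<chi> j. det (elimination_matrix A k (axis j 1)))"

text \<open>Cofactor expansion along row \<open>k\<close>, from linearity of the determinant in that
  row.\<close>

lemma det_elimination_matrix: "det (elimination_matrix A k v) = v \<bullet> elimination_vector A k"
proof -
  let ?c = "\<lambda>i. if i < k then A $ i else axis i 1"
  have M: "elimination_matrix A k u = (\<chi> i. if i = k then u else ?c i)" for u
    by (auto simp: elimination_matrix_def vec_eq_iff)
  have "det (elimination_matrix A k v)
      = det (\<chi> i. if i = k then (\<Sum>j\<in>UNIV. v $ j *s axis j 1) else ?c i)"
    unfolding M basis_expansion ..
  also have "\<dots> = (\<Sum>j\<in>UNIV. v $ j * det (elimination_matrix A k (axis j 1)))"
    unfolding M det_linear_row_sum[OF finite] det_row_mul ..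
  finally show ?thesis
    by (simp add: elimination_vector_def inner_vec_def)
qed

lemma elimination_matrix_rows:
  assumes "\<And>i. i < k \<Longrightarrow> A $ i = B $ i"
  shows "elimination_matrix A k = elimination_matrix B k"
  using assms by (auto simp: elimination_matrix_def fun_eq_iff vec_eq_iff)

text \<open>Inserting an earlier row of \<open>A\<close> as row \<open>k\<close> repeats a row, so
  the determinant vanishes.\<close>

lemma elimination_vector_orthogonal:
  assumes "i < k"
  shows "A $ i \<bullet> elimination_vector A k = 0"
proof -
  have "det (elimination_matrix A k (A $ i)) = 0"
    using assms by (intro det_identical_rows[of i k]) (auto simp: row_def elimination_matrix_def)
  then show ?thesis by (simp add: det_elimination_matrix)
qed

text \<open>For \<open>j\<close> after \<open>k\<close>, the inserted unit vector repeats the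
  identity row \<open>j\<close>.\<close>

lemma elimination_vector_support:
  assumes "k < j"
  shows "elimination_vector A k $ j = 0"
  unfolding elimination_vector_def vec_lambda_beta
  using assms by (intro det_identical_rows[of j k]) (auto simp: row_def elimination_matrix_def)

text \<open>The \<open>k\<close>-th entry of the \<open>k\<close>-th elimination vector is the leading principal minor that
  precedes row \<open>k\<close>. If \<open>p\<close> is the index just before \<open>k\<close>, it equals \<open>a\<^sub>p \<bullet> w\<^sup>p\<close>.\<close>
lemma elimination_vector_diag_nonzero:
  assumes "\<And>j. elimination_vector A j \<noteq> 0 \<Longrightarrow> A $ j \<bullet> elimination_vector A j \<noteq> 0"
  shows "elimination_vector A k $ k \<noteq> 0"
proof (induction k rule: less_induct)
  case (less k)
  show ?case
  proof (cases "\<exists>i. i < k")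
    case False
    then have "elimination_matrix A k (axis k 1) = mat 1"
      by (auto simp: elimination_matrix_def mat_def axis_def vec_eq_iff)
    then show ?thesis by (simp add: elimination_vector_def)
  next
    case True
    define p where "p = Max {..<k}"
    have p: "p < k" using True unfolding p_def by (subst Max_less_iff) auto
    have le: "i \<le> p \<longleftrightarrow> i < k" for i
      using p Max_ge[of "{..<k}" i] by (auto simp: p_def)
    \<comment> \<open>The unit vector inserted at \<open>k\<close> is the identity row that the
      matrix for \<open>p\<close> already has there; all rows up to \<open>p\<close> come from
      \<open>A\<close> on both sides.\<close>
    have "elimination_matrix A k (axis k 1) $ i = elimination_matrix A p (A $ p) $ i" for i
      using le[of i] by (cases "i < p"; cases "i = p"; cases "i = k") (simp_all add: elimination_matrix_def, use p in auto)
    then have "elimination_matrix A k (axis k 1) = elimination_matrix A p (A $ p)"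
      by (subst vec_eq_iff) blast
    then have "elimination_vector A k $ k = A $ p \<bullet> elimination_vector A p"
      by (metis det_elimination_matrix inner_axis' inner_real_def mult_1)
    moreover have "elimination_vector A p \<noteq> 0"
      using less[OF p] by auto
    ultimately show ?thesis using assms by simp
  qed
qed

section \<open>Triangular systems and the LU factorization\<close>

lemma unit_lower_triangular_mult_eq_axis:
  assumes L: "unit_lower_triangular L" and z: "\<And>j. j < k \<Longrightarrow> (L *v v) $ j = 0"
    and supp: "\<And>j. k < j \<Longrightarrow> v $ j = 0"
  shows "v = v $ k *s axis k 1"
proof -
  \<comment> \<open>Forward substitution: row \<open>j\<close> of the system has only the unit
    diagonal term left once the earlier entries vanish.\<close>
  have "v $ j = 0" if "j < k" for j
    using that
  proof (induction j rule: less_induct)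
    case (less j)
    have "0 = (\<Sum>i\<in>UNIV. L $ j $ i * v $ i)"
      using z[OF less.prems] by (simp add: matrix_vector_mult_def)
    also have "\<dots> = (\<Sum>i\<in>{j}. L $ j $ i * v $ i)"
    proof (intro sum.mono_neutral_right ballI)
      fix i assume "i \<in> UNIV - {j}"
      then consider "i < j" | "j < i" by fastforce
      then show "L $ j $ i * v $ i = 0"
        using less L by cases (auto simp: unit_lower_triangular_def)
    qed auto
    finally show ?case using L by (simp add: unit_lower_triangular_def)
  qed
  then show ?thesis
    using supp by (auto simp: vec_eq_iff axis_def) (metis not_less_iff_gr_or_eq)
qed

lemma upper_triangular_mult_support:
  assumes "upper_triangular U" "\<And>j. k < j \<Longrightarrow> v $ j = 0" "k < i"
  shows "(U *v v) $ i = 0"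
proof -
  have "(\<Sum>j\<in>UNIV. U $ i $ j * v $ j) = 0"
  proof (intro sum.neutral ballI)
    fix j show "U $ i $ j * v $ j = 0"
      using assms by (cases "j < i") (auto simp: upper_triangular_def)
  qed
  then show ?thesis by (simp add: matrix_vector_mult_def)
qed

lemma det_unit_lower_triangular: "unit_lower_triangular L \<Longrightarrow> det L = 1"
  by (subst det_lowerdiagonal) (auto simp: unit_lower_triangular_def)

text \<open>If \<open>A = L U\<close> and \<open>w\<close> is the \<open>k\<close>-th elimination vector, then \<open>U w\<close> is a multiple of \<open>e\<^sub>k\<close>.\<close>
lemma LU_factorization_entry:
  assumes "LU_factorization A L U"
  shows "L $ i $ k * (A $ k \<bullet> elimination_vector A k) = A $ i \<bullet> elimination_vector A k"
proof -
  have L: "unit_lower_triangular L" and U: "upper_triangular U" and A: "A = L ** U"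
    using assms by (auto simp: LU_factorization_def)
  let ?w = "elimination_vector A k"
  let ?v = "U *v ?w"
  have Lv: "(L *v ?v) $ j = A $ j \<bullet> ?w" for j
    using A by (simp add: matrix_vector_mul_assoc flip: matrix_vector_mul_component)
  \<comment> \<open>Entries of \<open>L *v ?v\<close> before \<open>k\<close> vanish by
    orthogonality, entries of \<open>?v\<close> after \<open>k\<close> by triangularity of
    \<open>U\<close>.\<close>
  have "?v = ?v $ k *s axis k 1"
    by (rule unit_lower_triangular_mult_eq_axis[OF L])
      (auto simp: Lv elimination_vector_orthogonal
        intro!: upper_triangular_mult_support[OF U] elimination_vector_support)
  then have "L *v ?v = ?v $ k *s (L *v axis k 1)"
    by (metis vector_scalar_commute)
  then have "A $ j \<bullet> ?w = ?v $ k * L $ j $ k" for j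
    by (simp flip: Lv add: matrix_vector_mul_component inner_axis)
  \<comment> \<open>Row \<open>k\<close>, where the entry of \<open>L\<close> is 1, identifies the
    scalar \<open>?v $ k\<close> as the pivot product.\<close>
  then show ?thesis
    using L by (simp add: unit_lower_triangular_def)
qed

text \<open>The vectors \<open>w k\<close> are the columns of an upper-triangular matrix with
  nonzero diagonal, and \<open>U\<close> times it is diagonal. Induction over columns solves for the
  entries of \<open>U\<close>.\<close>

lemma upper_triangular_if_maps_to_axis:
  assumes W: "\<And>k j. k < j \<Longrightarrow> w k $ j = 0" "\<And>k. w k $ k \<noteq> 0"
    and U: "\<And>k. U *v w k = d k *s axis k 1"
  shows "upper_triangular U"
proof -
  have "\<forall>i. j < i \<longrightarrow> U $ i $ j = 0" for j
  proof (induction j rule: less_induct)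
    case (less j)
    show ?case
    proof (intro allI impI)
      fix i assume ij: "j < i"
      have "0 = (\<Sum>m\<in>UNIV. U $ i $ m * w j $ m)"
        using arg_cong[OF U[of j], of "\<lambda>v. v $ i"] ij
        by (simp add: matrix_vector_mult_def axis_def)
      also have "\<dots> = (\<Sum>m\<in>{j}. U $ i $ m * w j $ m)"
      proof (intro sum.mono_neutral_right ballI)
        fix m assume "m \<in> UNIV - {j}"
        then consider "m < j" | "j < m" by fastforce
        then show "U $ i $ m * w j $ m = 0"
          using less ij W(1)[of j m] by cases auto
      qed auto
      finally show "U $ i $ j = 0" using W(2)[of j] by simp
    qed
  qed
  then show ?thesis by (simp add: upper_triangular_def)
qed

text \<open>Nonzero pivots force the entries of \<open>L\<close> to be the ratios of inner products,
  and then \<open>U\<close> is the inverse of \<open>L\<close> times \<open>A\<close>. The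
  hypothesis is conditional because bounds on normalised vectors only give it in that form;
  induction along the leading minors removes the condition.\<close>

lemma LU_factorization_unique_exists:
  assumes nz: "\<And>k. elimination_vector A k \<noteq> 0 \<Longrightarrow> A $ k \<bullet> elimination_vector A k \<noteq> 0"
  shows "\<exists>!LU. LU_factorization A (fst LU) (snd LU)"
proof -
  let ?w = "elimination_vector A"
  have w: "?w k $ k \<noteq> 0" for k
    using nz by (rule elimination_vector_diag_nonzero)
  then have "?w k \<noteq> 0" for k
    by (metis zero_index)
  then have d: "A $ k \<bullet> ?w k \<noteq> 0" for k
    using nz by blast
  define L where "L = (\<chi> i k. (A $ i \<bullet> ?w k) / (A $ k \<bullet> ?w k))"
  have L: "unit_lower_triangular L"
    using d by (auto simp: L_def unit_lower_triangular_def elimination_vector_orthogonal)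
  then have "invertible L"
    by (simp add: det_unit_lower_triangular invertible_det_nz)
  then obtain L' where L': "L' ** L = mat 1" "L ** L' = mat 1"
    by (auto simp: invertible_def)
  define U where "U = L' ** A"
  have A: "A = L ** U"
    by (simp add: U_def matrix_mul_assoc L')
  \<comment> \<open>Cancelling \<open>L\<close> turns this into the action of \<open>U\<close> on
    the elimination vectors, from which \<open>U\<close> is seen to be upper-triangular.\<close>
  have "A *v ?w k = L *v ((A $ k \<bullet> ?w k) *s axis k 1)" for k
    using d by (simp add: vec_eq_iff matrix_vector_mul_component vector_scalar_commute inner_axis
        inner_scaleR_right scalar_mult_eq_scaleR L_def)
  then have "U *v ?w k = (A $ k \<bullet> ?w k) *s axis k 1" for k
    by (metis L'(1) U_def matrix_vector_mul_assoc matrix_vector_mul_lid)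
  then have "upper_triangular U"
    using w elimination_vector_support by (intro upper_triangular_if_maps_to_axis[of ?w]) auto
  with L A have LU: "LU_factorization A (fst (L, U)) (snd (L, U))"
    by (simp add: LU_factorization_def)
  have "P = (L, U)" if P: "LU_factorization A (fst P) (snd P)" for P
  proof (rule prod_eqI)
    show *: "fst P = fst (L, U)"
      using LU_factorization_entry[OF P] d by (simp add: vec_eq_iff L_def eq_divide_eq)
    have "L' ** (L ** snd P) = L' ** A"
      using P * by (simp add: LU_factorization_def)
    then show "snd P = snd (L, U)"
      by (simp add: matrix_mul_assoc L' U_def)
  qed
  with LU show ?thesis
    by (rule ex1I)
qed

text \<open>Every entry of \<open>L\<close> is at most \<open>y\<close> in absolute value, the
  diagonal ones because \<open>1 \<le> y\<close>. Uniqueness of the factorization rules out the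
  value \<infinity>.\<close>

lemma growth_factor_L_le:
  fixes A :: "'n::{finite,wellorder} sq_matrix"
  assumes nz: "\<And>k. elimination_vector A k \<noteq> 0 \<Longrightarrow> A $ k \<bullet> elimination_vector A k \<noteq> 0"
    and le: "\<And>i k. k < i \<Longrightarrow>
      \<bar>A $ i \<bullet> elimination_vector A k\<bar> \<le> y * \<bar>A $ k \<bullet> elimination_vector A k\<bar>"
    and y: "1 \<le> y"
  shows "growth_factor_L A \<le> ereal (real CARD('n) * y)"
proof -
  have ex1: "\<exists>!LU. LU_factorization A (fst LU) (snd LU)"
    by (rule LU_factorization_unique_exists[OF nz])
  have "max_row_sum L \<le> real CARD('n) * y" if LU: "LU_factorization A L U" for L U
  proof -
    have "\<bar>L $ i $ k\<bar> \<le> y" for i k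
    proof (cases "k < i")
      case True
      have "elimination_vector A k \<noteq> 0"
        using elimination_vector_diag_nonzero[OF nz, of k] by auto
      then have "0 < \<bar>A $ k \<bullet> elimination_vector A k\<bar>" using nz by simp
      moreover have "\<bar>L $ i $ k\<bar> * \<bar>A $ k \<bullet> elimination_vector A k\<bar> \<le> y * \<bar>A $ k \<bullet> elimination_vector A k\<bar>"
        using le[OF True] by (simp flip: abs_mult add: LU_factorization_entry[OF LU])
      ultimately show ?thesis by simp
    next
      case False
      then show ?thesis
        using LU y by (cases "i = k") (auto simp: LU_factorization_def unit_lower_triangular_def)
    qed
    then have "(\<Sum>k\<in>UNIV. \<bar>L $ i $ k\<bar>) \<le> real CARD('n) * y" for i
      using sum_bounded_above[of UNIV "\<lambda>k. \<bar>L $ i $ k\<bar>" y] by simp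
    then have "\<not> real CARD('n) * y < max_row_sum L"
      by (simp add: max_row_sum_gt_iff not_less)
    then show ?thesis by simp
  qed
  then have "\<not> ereal (real CARD('n) * y) < growth_factor_L A"
    using ex1 unfolding growth_factor_L_gt_iff
    by (metis fst_conv snd_conv not_le)
  then show ?thesis by simp
qed

section \<open>Gaussian tail estimates\<close>

text \<open>An explicit antiderivative computes the exponential integral that will dominate one
  Gaussian tail.\<close>

lemma nn_integral_linear_exp_tail:
  fixes a t :: real
  assumes "0 < a"
  shows "(\<integral>\<^sup>+ s. ennreal ((s - t) * exp (- a * (s - t))) * indicator {t..} s \<partial>lborel) = ennreal (1 / a\<^sup>2)"
proof -
  have "(\<integral>\<^sup>+ s. ennreal ((s - t) * exp (- a * (s - t))) * indicator {t..} s \<partial>lborel)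
      = ennreal (0 - (- ((t - t) / a + 1 / a\<^sup>2) * exp (- a * (t - t))))"
  proof (rule nn_integral_FTC_atLeast[where F = "\<lambda>s. - ((s - t) / a + 1 / a\<^sup>2) * exp (- a * (s - t))"])
    show "((\<lambda>s. - ((s - t) / a + 1 / a\<^sup>2) * exp (- a * (s - t))) \<longlongrightarrow> 0) at_top"
      using assms by real_asymp
    show "DERIV (\<lambda>s. - ((s - t) / a + 1 / a\<^sup>2) * exp (- a * (s - t))) s :> (s - t) * exp (- a * (s - t))" for s
      using assms by (auto intro!: derivative_eq_intros simp: field_simps power2_eq_square)
  qed (use assms in auto)
  then show ?thesis by simp
qed

text \<open>On \<open>s \<ge> t\<close> the Gaussian exponent lies below its tangent at \<open>t\<close>.\<close>
lemma normal_density_tangent_bound: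
  assumes "0 < \<sigma>"
  shows "normal_density 0 \<sigma> s \<le> normal_density 0 \<sigma> t * exp (- (t / \<sigma>\<^sup>2) * (s - t))"
proof -
  have "0 \<le> (s - t)\<^sup>2" by simp
  then have "- s\<^sup>2 \<le> - t\<^sup>2 - 2 * t * (s - t)"
    by (simp add: power2_eq_square algebra_simps)
  then have "- s\<^sup>2 / (2 * \<sigma>\<^sup>2) \<le> (- t\<^sup>2 - 2 * t * (s - t)) / (2 * \<sigma>\<^sup>2)"
    by (rule divide_right_mono) simp
  also have "\<dots> = - t\<^sup>2 / (2 * \<sigma>\<^sup>2) + - (t / \<sigma>\<^sup>2) * (s - t)"
    using assms by (simp add: field_simps)
  finally show ?thesis
    by (simp add: normal_density_def divide_right_mono flip: exp_add)
qed

lemma normal_density_uminus: "normal_density 0 \<sigma> (- s) = normal_density 0 \<sigma> s"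
  by (simp add: normal_density_def)

text \<open>In each tail the tangent bound replaces the density by an exponential of rate
  \<open>t / \<sigma>\<^sup>2\<close>, whose excess integral is
  \<open>\<sigma> ^ 4 / t\<^sup>2\<close>. The factor 2 counts the two tails.\<close>

lemma normal_excess_bound:
  assumes \<sigma>: "0 < \<sigma>" and t: "0 < t"
  shows "(\<integral>\<^sup>+ s. ennreal (max 0 (\<bar>s\<bar> - t)) * ennreal (normal_density 0 \<sigma> s) \<partial>lborel)
    \<le> ennreal (2 * \<sigma> ^ 4 / t\<^sup>2 * normal_density 0 \<sigma> t)"
proof -
  define h where "h s = ennreal (normal_density 0 \<sigma> t) *
      (ennreal ((s - t) * exp (- (t / \<sigma>\<^sup>2) * (s - t))) * indicator {t..} s)" for s
  have [measurable]: "h \<in> borel_measurable borel"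
    unfolding h_def by measurable
  have key: "ennreal ((s - t) * normal_density 0 \<sigma> s) \<le> h s" if "t \<le> s" for s
  proof -
    have "(s - t) * normal_density 0 \<sigma> s
        \<le> (s - t) * (normal_density 0 \<sigma> t * exp (- (t / \<sigma>\<^sup>2) * (s - t)))"
      using that by (intro mult_left_mono normal_density_tangent_bound \<sigma>) auto
    then show ?thesis
      using that by (simp add: h_def ennreal_mult'[symmetric] ac_simps)
  qed
  have pt: "ennreal (max 0 (\<bar>s\<bar> - t)) * ennreal (normal_density 0 \<sigma> s) \<le> h s + h (- s)" for s
  proof -
    consider "\<bar>s\<bar> < t" | "t \<le> s" | "t \<le> - s" by linarith
    then show ?thesis
    proof cases
      case 2
      then show ?thesis
        using key[of s] t by (intro add_increasing2) (auto simp flip: ennreal_mult')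
    next
      case 3
      then show ?thesis
        using key[of "- s"] t
        by (intro add_increasing) (auto simp: normal_density_uminus simp flip: ennreal_mult')
    qed simp
  qed
  have h: "(\<integral>\<^sup>+ s. h s \<partial>lborel) = ennreal (\<sigma> ^ 4 / t\<^sup>2 * normal_density 0 \<sigma> t)"
  proof -
    have "(\<integral>\<^sup>+ s. h s \<partial>lborel) = ennreal (normal_density 0 \<sigma> t) * ennreal (1 / (t / \<sigma>\<^sup>2)\<^sup>2)"
      unfolding h_def
      by (subst nn_integral_cmult, measurable, subst nn_integral_linear_exp_tail) (use \<sigma> t in auto)
    also have "\<dots> = ennreal (\<sigma> ^ 4 / t\<^sup>2 * normal_density 0 \<sigma> t)"
      by (simp add: power_divide power_mult[symmetric] mult.commute flip: ennreal_mult')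
    finally show ?thesis .
  qed
  have "(\<integral>\<^sup>+ s. h (- s) \<partial>lborel) = (\<integral>\<^sup>+ s. h s \<partial>lborel)"
    using nn_integral_real_affine[of h "-1" 0] by simp
  then have "(\<integral>\<^sup>+ s. h s + h (- s) \<partial>lborel) = ennreal (2 * \<sigma> ^ 4 / t\<^sup>2 * normal_density 0 \<sigma> t)"
    by (subst nn_integral_add) (auto simp: h simp flip: ennreal_plus)
  moreover have "(\<integral>\<^sup>+ s. ennreal (max 0 (\<bar>s\<bar> - t)) * ennreal (normal_density 0 \<sigma> s) \<partial>lborel)
      \<le> (\<integral>\<^sup>+ s. h s + h (- s) \<partial>lborel)"
    by (intro nn_integral_mono pt)
  ultimately show ?thesis by simp
qed

text \<open>The density is at most \<open>1 / (sqrt (2 * pi) * \<sigma>)\<close>, and the event lies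
  in an interval of length \<open>2 * b / y\<close>.\<close>

lemma normal_small_ball:
  assumes \<sigma>: "0 < \<sigma>" and y: "0 < y" and b: "0 \<le> b"
  shows "(\<integral>\<^sup>+ s. indicator {s. y * \<bar>c + s\<bar> < b} s * ennreal (normal_density 0 \<sigma> s) \<partial>lborel)
    \<le> ennreal (sqrt (2 / pi) / (y * \<sigma>) * b)"
proof -
  have "(\<integral>\<^sup>+ s. indicator {s. y * \<bar>c + s\<bar> < b} s * ennreal (normal_density 0 \<sigma> s) \<partial>lborel)
     \<le> (\<integral>\<^sup>+ s. ennreal (1 / (sqrt (2 * pi) * \<sigma>)) * indicator {- c - b / y .. - c + b / y} s \<partial>lborel)"
  proof (rule nn_integral_mono)
    fix s
    have "normal_density 0 \<sigma> s \<le> 1 / (sqrt (2 * pi) * \<sigma>)"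
      using \<sigma> by (simp add: normal_density_def real_sqrt_mult divide_right_mono)
    moreover have "s \<in> {- c - b / y .. - c + b / y}" if "y * \<bar>c + s\<bar> < b"
    proof -
      have "\<bar>c + s\<bar> < b / y"
        using that y by (simp add: field_simps)
      then show ?thesis by auto
    qed
    ultimately show "indicator {s. y * \<bar>c + s\<bar> < b} s * ennreal (normal_density 0 \<sigma> s)
      \<le> ennreal (1 / (sqrt (2 * pi) * \<sigma>)) * indicator {- c - b / y .. - c + b / y} s"
      by (auto simp: indicator_def ennreal_leI)
  qed
  also have "\<dots> = ennreal (1 / (sqrt (2 * pi) * \<sigma>) * (2 * b / y))"
    using y b \<sigma> by (simp add: nn_integral_cmult flip: ennreal_mult')
  also have "1 / (sqrt (2 * pi) * \<sigma>) * (2 * b / y) = sqrt (2 / pi) / (y * \<sigma>) * b"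
    using y \<sigma> by (simp add: real_sqrt_mult real_sqrt_divide field_simps)
  finally show ?thesis .
qed

section \<open>Conditioning on all rows but one\<close>

lemma borel_measurable_vec_componentwise:
  fixes f :: "'a \<Rightarrow> 'b::euclidean_space^'n"
  assumes "\<And>i. (\<lambda>x. f x $ i) \<in> borel_measurable M"
  shows "f \<in> borel_measurable M"
proof -
  have "(\<lambda>x. f x \<bullet> b) \<in> borel_measurable M" if b: "b \<in> Basis" for b
  proof -
    obtain i c where "b = axis i c" using b by (auto simp: Basis_vec_def)
    then show ?thesis using assms by (simp add: inner_axis)
  qed
  then show ?thesis using borel_measurable_euclidean_space by blast
qed

lemma borel_measurable_vec_nth [measurable (raw)]:
  fixes f :: "'a \<Rightarrow> 'b::euclidean_space^'n"
  assumes "f \<in> borel_measurable M"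
  shows "(\<lambda>x. f x $ i) \<in> borel_measurable M"
  by (rule borel_measurable_continuous_on[OF _ assms]) (intro continuous_intros)

lemma continuous_on_det: "continuous_on S (det :: real^'n^'n \<Rightarrow> real)"
  unfolding det_def by (intro continuous_intros)

lemma borel_measurable_elimination_vector:
  "(\<lambda>A. elimination_vector A k) \<in> borel_measurable borel"
proof (intro borel_measurable_continuous_onI)
  have "continuous_on UNIV (\<lambda>A. elimination_matrix A k v)" for v
    unfolding elimination_matrix_def
  proof (intro continuous_on_vec_lambda)
    show "continuous_on UNIV (\<lambda>A. if i < k then A $ i else if i = k then v else axis i 1)" for i
      by (cases "i < k"; cases "i = k") (auto intro!: continuous_intros)
  qed
  then show "continuous_on UNIV (\<lambda>A. elimination_vector A k)"
    unfolding elimination_vector_def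
    by (intro continuous_on_vec_lambda continuous_on_compose2[OF continuous_on_det]) auto
qed

text \<open>The default \<open>axis k 1\<close> keeps this a unit vector for every matrix, so that
  projections along it are Gaussian without exception.\<close>

definition elimination_direction :: "'n::{finite,wellorder} sq_matrix \<Rightarrow> 'n \<Rightarrow> real^'n::{finite,wellorder}" where
  "elimination_direction A k =
    (if elimination_vector A k = 0 then axis k 1 else sgn (elimination_vector A k))"

lemma borel_measurable_elimination_direction [measurable]:
  "(\<lambda>A. elimination_direction A k) \<in> borel_measurable borel"
  using borel_measurable_elimination_vector[of k, measurable]
  unfolding elimination_direction_def sgn_div_norm by measurable

lemma norm_elimination_direction: "norm (elimination_direction A k) = 1"
  by (simp add: elimination_direction_def norm_sgn norm_axis_1)

lemma elimination_vector_eq_direction: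
  "elimination_vector A k = norm (elimination_vector A k) *\<^sub>R elimination_direction A k"
  by (simp add: elimination_direction_def sgn_div_norm)

lemma elimination_direction_cong:
  assumes "\<And>i. i < k \<Longrightarrow> A $ i = B $ i"
  shows "elimination_direction A k = elimination_direction B k"
  using elimination_matrix_rows[OF assms] by (simp add: elimination_direction_def elimination_vector_def)

text \<open>Zeroing the row instead of deleting it keeps the matrix type, so functions of the whole
  matrix still apply to the remaining rows.\<close>

definition without_row :: "'n \<Rightarrow> 'a::zero^'m^'n \<Rightarrow> 'a^'m^'n" where
  "without_row i B = (\<chi> r. if r = i then 0 else B $ r)"

section \<open>Conditional law of one row of a Gaussian matrix\<close>

locale gaussian_matrix = prob_space M for M :: "'w measure" +
  fixes G :: "'w \<Rightarrow> real^'m^'n" and \<sigma> :: real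
  assumes indep_entries: "indep_vars (\<lambda>_. borel) (\<lambda>(i, j) \<omega>. G \<omega> $ i $ j) UNIV"
    and normal_entries: "distributed M lborel (\<lambda>\<omega>. G \<omega> $ i $ j) (normal_density 0 \<sigma>)"
    and sigma_pos: "0 < \<sigma>"
begin

lemma measurable_G [measurable]: "G \<in> borel_measurable M"
  using distributed_measurable[OF normal_entries]
  by (intro borel_measurable_vec_componentwise) simp

text \<open>The two sides are functions of disjoint blocks of the independent entries. Row
  \<open>i\<close> is carried as a matrix whose other rows are zero.\<close>

lemma indep_row:
  "indep_var borel (\<lambda>\<omega>. without_row i (G \<omega>)) borel (\<lambda>\<omega>. G \<omega> - without_row i (G \<omega>))"
proof -
  let ?A = "{p :: 'n \<times> 'm. fst p \<noteq> i}" and ?B = "{p :: 'n \<times> 'm. fst p = i}"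
  let ?X = "\<lambda>(i, j) \<omega>. G \<omega> $ i $ j"
  define f :: "('n \<times> 'm \<Rightarrow> real) \<Rightarrow> real^'m^'n"
    where "f x = (\<chi> r j. if r = i then 0 else x (r, j))" for x
  define g :: "('n \<times> 'm \<Rightarrow> real) \<Rightarrow> real^'m^'n"
    where "g x = (\<chi> r j. if r = i then x (r, j) else 0)" for x
  have "(\<lambda>x. if r = i then 0 else x (r, j)) \<in> borel_measurable (PiM ?A (\<lambda>_. borel :: real measure))"
    "(\<lambda>x. if r = i then x (r, j) else 0) \<in> borel_measurable (PiM ?B (\<lambda>_. borel :: real measure))"
    for r j by (cases "r = i"; auto intro!: measurable_component_singleton)+
  then have f: "f \<in> PiM ?A (\<lambda>_. borel) \<rightarrow>\<^sub>M borel" and g: "g \<in> PiM ?B (\<lambda>_. borel) \<rightarrow>\<^sub>M borel"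
    unfolding f_def g_def by (intro borel_measurable_vec_componentwise; simp)+
  have "indep_var borel (f \<circ> (\<lambda>\<omega>. restrict (\<lambda>p. ?X p \<omega>) ?A)) borel (g \<circ> (\<lambda>\<omega>. restrict (\<lambda>p. ?X p \<omega>) ?B))"
    by (intro indep_var_compose[OF indep_var_restrict[OF indep_entries] f g]) auto
  moreover have "f \<circ> (\<lambda>\<omega>. restrict (\<lambda>p. ?X p \<omega>) ?A) = (\<lambda>\<omega>. without_row i (G \<omega>))"
    by (auto simp: f_def without_row_def fun_eq_iff vec_eq_iff)
  moreover have "g \<circ> (\<lambda>\<omega>. restrict (\<lambda>p. ?X p \<omega>) ?B) = (\<lambda>\<omega>. G \<omega> - without_row i (G \<omega>))"
    by (auto simp: g_def without_row_def fun_eq_iff vec_eq_iff)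
  ultimately show ?thesis by simp
qed

text \<open>A sum of independent normals is normal, and the variances add up to \<sigma> squared
  times the squared norm of \<open>u\<close>.\<close>

lemma normal_row_inner:
  assumes u: "norm u = 1"
  shows "distributed M lborel (\<lambda>\<omega>. G \<omega> $ i \<bullet> u) (normal_density 0 \<sigma>)"
proof -
  \<comment> \<open>Zero coefficients are dropped: their terms are degenerate and have no normal
    density.\<close>
  let ?J = "{j. u $ j \<noteq> 0}"
  let ?P = "{i} \<times> ?J"
  let ?X = "\<lambda>p \<omega>. u $ snd p * (case p of (i, j) \<Rightarrow> \<lambda>\<omega>. G \<omega> $ i $ j) \<omega>"
  have "?J \<noteq> {}"
  proof
    assume "?J = {}"
    then have "u = 0" by (simp add: vec_eq_iff)
    with u show False by simp
  qed
  then have ne: "?P \<noteq> {}" by auto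
  have sum_P: "sum f ?P = (\<Sum>j\<in>?J. f (i, j))" for f :: "_ \<Rightarrow> real"
    using sum.cartesian_product[of "\<lambda>i j. f (i, j)" ?J "{i}"] by simp
  have ind: "indep_vars (\<lambda>_. borel) ?X ?P"
    by (intro indep_vars_compose2[OF indep_vars_subset[OF indep_entries]]) auto
  have "distributed M lborel (?X p) (normal_density 0 (\<bar>u $ snd p\<bar> * \<sigma>))" if "p \<in> ?P" for p
    using normal_density_affine[OF normal_entries sigma_pos, of "u $ snd p" 0] that by auto
  then have "distributed M lborel (\<lambda>\<omega>. \<Sum>p\<in>?P. ?X p \<omega>)
      (normal_density (\<Sum>p\<in>?P. 0) (sqrt (\<Sum>p\<in>?P. (\<bar>u $ snd p\<bar> * \<sigma>)\<^sup>2)))"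
    using sigma_pos by (intro sum_indep_normal ind ne) auto
  moreover have "(\<Sum>p\<in>?P. ?X p \<omega>) = G \<omega> $ i \<bullet> u" for \<omega>
    unfolding sum_P inner_vec_def by (auto intro!: sum.mono_neutral_cong_left)
  moreover have "(\<Sum>p\<in>?P. (\<bar>u $ snd p\<bar> * \<sigma>)\<^sup>2) = \<sigma>\<^sup>2"
  proof -
    have "(\<Sum>p\<in>?P. (\<bar>u $ snd p\<bar> * \<sigma>)\<^sup>2) = (\<Sum>j\<in>UNIV. (u $ j)\<^sup>2) * \<sigma>\<^sup>2"
      unfolding sum_P sum_distrib_right power_mult_distrib power2_abs snd_conv
      by (intro sum.mono_neutral_left) auto
    also have "(\<Sum>j\<in>UNIV. (u $ j)\<^sup>2) = (norm u)\<^sup>2"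
      unfolding power2_norm_eq_inner inner_vec_def by (simp add: power2_eq_square)
    finally show ?thesis by (simp add: u)
  qed
  ultimately show ?thesis using sigma_pos by simp
qed

text \<open>Conditionally on the other rows, the component of row \<open>i\<close> along a unit vector determined by
  those rows is still a centred Gaussian.\<close>
lemma nn_integral_row_inner:
  fixes u :: "real^'m^'n \<Rightarrow> real^'m" and F :: "(real^'m^'n) \<times> real \<Rightarrow> ennreal"
  assumes u [measurable]: "u \<in> borel_measurable borel" and norm_u: "\<And>z. norm (u z) = 1"
    and F [measurable]: "F \<in> borel_measurable borel"
  shows "(\<integral>\<^sup>+ \<omega>. F (without_row i (G \<omega>), G \<omega> $ i \<bullet> u (without_row i (G \<omega>))) \<partial>M) =
    (\<integral>\<^sup>+ \<omega>. (\<integral>\<^sup>+ s. F (without_row i (G \<omega>), s) * ennreal (normal_density 0 \<sigma> s) \<partial>lborel) \<partial>M)"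
proof -
  let ?Z = "\<lambda>\<omega>. without_row i (G \<omega>)"
  let ?Y = "\<lambda>\<omega>. G \<omega> - ?Z \<omega>"
  have Y: "?Y \<omega> $ i = G \<omega> $ i" for \<omega> by (simp add: without_row_def)
  have [measurable]: "?Z \<in> borel_measurable M" "?Y \<in> borel_measurable M"
    and prod: "distr M borel ?Z \<Otimes>\<^sub>M distr M borel ?Y = distr M (borel \<Otimes>\<^sub>M borel) (\<lambda>\<omega>. (?Z \<omega>, ?Y \<omega>))"
    using indep_row[of i] unfolding indep_var_distribution_eq by auto
  have F' [measurable]: "F \<in> borel_measurable (borel \<Otimes>\<^sub>M borel)"
    using F by (simp add: borel_prod)
  interpret Y: prob_space "distr M borel ?Y"
    by (rule prob_space_distr) measurable
  have "(\<integral>\<^sup>+ \<omega>. F (?Z \<omega>, G \<omega> $ i \<bullet> u (?Z \<omega>)) \<partial>M) = (\<integral>\<^sup>+ \<omega>. F (?Z \<omega>, ?Y \<omega> $ i \<bullet> u (?Z \<omega>)) \<partial>M)"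
    by (simp only: Y)
  \<comment> \<open>Independence makes the joint law a product. Once Fubini fixes \<open>z\<close>,
    the vector \<open>u z\<close> is deterministic and the law of \<open>normal_row_inner\<close>
    applies.\<close>
  also have "\<dots> = (\<integral>\<^sup>+ p. F (fst p, snd p $ i \<bullet> u (fst p)) \<partial>(distr M borel ?Z \<Otimes>\<^sub>M distr M borel ?Y))"
    unfolding prod by (subst nn_integral_distr) auto
  also have "\<dots> = (\<integral>\<^sup>+ z. \<integral>\<^sup>+ v. F (z, v $ i \<bullet> u z) \<partial>distr M borel ?Y \<partial>distr M borel ?Z)"
    by (subst Y.nn_integral_fst[symmetric]) auto
  also have "\<dots> = (\<integral>\<^sup>+ z. \<integral>\<^sup>+ s. F (z, s) * ennreal (normal_density 0 \<sigma> s) \<partial>lborel \<partial>distr M borel ?Z)"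
  proof (rule nn_integral_cong)
    fix z
    have "(\<integral>\<^sup>+ v. F (z, v $ i \<bullet> u z) \<partial>distr M borel ?Y) = (\<integral>\<^sup>+ \<omega>. F (z, ?Y \<omega> $ i \<bullet> u z) \<partial>M)"
      by (subst nn_integral_distr) auto
    also have "\<dots> = (\<integral>\<^sup>+ s. ennreal (normal_density 0 \<sigma> s) * F (z, s) \<partial>lborel)"
      unfolding Y by (subst distributed_nn_integral[OF normal_row_inner[OF norm_u]]) auto
    finally show "(\<integral>\<^sup>+ v. F (z, v $ i \<bullet> u z) \<partial>distr M borel ?Y)
        = (\<integral>\<^sup>+ s. F (z, s) * ennreal (normal_density 0 \<sigma> s) \<partial>lborel)"
      by (simp add: mult.commute)
  qed
  also have "\<dots> = (\<integral>\<^sup>+ \<omega>. \<integral>\<^sup>+ s. F (?Z \<omega>, s) * ennreal (normal_density 0 \<sigma> s) \<partial>lborel \<partial>M)"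
    by (subst nn_integral_distr) auto
  finally show ?thesis .
qed

end

section \<open>Tail bound for the growth factor\<close>

text \<open>The term \<open>1\<close> bounds the contribution of \<open>Abar\<close> to the components \<open>a\<^sub>i \<bullet> u\<close>, \<open>i > k\<close>. The maximum of the
  Gaussian contributions is replaced by the threshold \<open>\<tau>\<close> plus the sum of all excesses over it.\<close>
definition numerator_bound :: "'n::{finite,wellorder} sq_matrix \<Rightarrow> real \<Rightarrow> 'n \<Rightarrow> 'n sq_matrix \<Rightarrow> real" where
  "numerator_bound Abar \<tau> k B =
    1 + \<tau> + (\<Sum>i\<in>{k<..}. max 0 (\<bar>B $ i \<bullet> elimination_direction (Abar + B) k\<bar> - \<tau>))"

lemma numerator_bound_pos: "0 \<le> \<tau> \<Longrightarrow> 0 < numerator_bound Abar \<tau> k B"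
  unfolding numerator_bound_def by (intro add_pos_nonneg sum_nonneg) auto

lemma borel_measurable_numerator_bound [measurable]:
  "numerator_bound Abar \<tau> k \<in> borel_measurable borel"
  unfolding numerator_bound_def
  by (measurable; simp)

lemma elimination_direction_without_row:
  assumes "k \<le> i"
  shows "elimination_direction (Abar + without_row i B) k = elimination_direction (Abar + B) k"
  using assms by (intro elimination_direction_cong) (auto simp: without_row_def)

text \<open>The direction uses rows before \<open>k\<close> and the sum uses rows after
  \<open>k\<close>. Conditioning on all rows but \<open>k\<close> therefore makes the bound a
  constant.\<close>

lemma numerator_bound_without_row:
  "numerator_bound Abar \<tau> k (without_row k B) = numerator_bound Abar \<tau> k B"
  unfolding numerator_bound_def elimination_direction_without_row[OF order_refl]
  by (auto simp: without_row_def intro!: sum.cong)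

lemma inner_row_le_onorm:
  fixes B :: "real^'m^'n"
  assumes "onorm (\<lambda>v. B *v v) \<le> 1" "norm u = 1"
  shows "\<bar>B $ i \<bullet> u\<bar> \<le> 1"
proof -
  have "\<bar>B $ i \<bullet> u\<bar> \<le> norm (B *v u)"
    using component_le_norm_cart[of "B *v u" i] by (simp add: matrix_vector_mul_component)
  also have "\<dots> \<le> onorm (\<lambda>v. B *v v) * norm u"
    by (intro onorm matrix_vector_mul_bounded_linear)
  finally show ?thesis using assms by simp
qed

text \<open>A value is at most \<tau> plus its excess, and one excess is at most the sum of all of
  them; the 1 pays for \<open>Abar\<close>.\<close>

lemma numerator_le_numerator_bound:
  assumes "onorm (\<lambda>v. Abar *v v) \<le> 1" "k < i"
  shows "\<bar>(Abar + B) $ i \<bullet> elimination_direction (Abar + B) k\<bar> \<le> numerator_bound Abar \<tau> k B"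
proof -
  let ?u = "elimination_direction (Abar + B) k"
  have "max 0 (\<bar>B $ i \<bullet> ?u\<bar> - \<tau>) \<le> (\<Sum>i\<in>{k<..}. max 0 (\<bar>B $ i \<bullet> ?u\<bar> - \<tau>))"
    using assms by (intro member_le_sum) auto
  moreover have "\<bar>Abar $ i \<bullet> ?u\<bar> \<le> 1"
    by (intro inner_row_le_onorm assms norm_elimination_direction)
  ultimately show ?thesis
    unfolding numerator_bound_def by (simp add: inner_add_left) linarith
qed

text \<open>Multiplying by the norm of the elimination vector passes from unit directions back to
  cofactors. Positivity of \<open>numerator_bound\<close> makes the pivots nonzero.\<close>

lemma growth_factor_L_le_if_pivots:
  fixes Abar B :: "'n::{finite,wellorder} sq_matrix"
  assumes Abar: "onorm (\<lambda>v. Abar *v v) \<le> 1" and \<tau>: "0 \<le> \<tau>" and y: "1 \<le> y"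
    and pivots: "\<And>k. numerator_bound Abar \<tau> k B
      \<le> y * \<bar>(Abar + B) $ k \<bullet> elimination_direction (Abar + B) k\<bar>"
  shows "growth_factor_L (Abar + B) \<le> ereal (real CARD('n) * y)"
proof (rule growth_factor_L_le[OF _ _ y])
  let ?A = "Abar + B"
  have inner_eq: "?A $ i \<bullet> elimination_vector ?A k
      = norm (elimination_vector ?A k) * (?A $ i \<bullet> elimination_direction ?A k)" for i k
    by (metis elimination_vector_eq_direction inner_scaleR_right)
  show "?A $ k \<bullet> elimination_vector ?A k \<noteq> 0" if "elimination_vector ?A k \<noteq> 0" for k
  proof -
    have "?A $ k \<bullet> elimination_direction ?A k \<noteq> 0"
      using pivots[of k] numerator_bound_pos[OF \<tau>, of Abar k B] by auto
    with that show ?thesis unfolding inner_eq by simp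
  qed
  show "\<bar>?A $ i \<bullet> elimination_vector ?A k\<bar> \<le> y * \<bar>?A $ k \<bullet> elimination_vector ?A k\<bar>"
    if "k < i" for i k
  proof -
    have "\<bar>?A $ i \<bullet> elimination_direction ?A k\<bar> \<le> y * \<bar>?A $ k \<bullet> elimination_direction ?A k\<bar>"
      using numerator_le_numerator_bound[OF Abar that, of B \<tau>] pivots[of k] by linarith
    then show ?thesis
      unfolding inner_eq abs_mult
      by (metis abs_ge_zero mult.left_commute mult_left_mono)
  qed
qed

section \<open>Expected numerators and small pivots\<close>

locale perturbed_square_matrix = gaussian_matrix M G \<sigma>
  for M :: "'w measure" and G :: "'w \<Rightarrow> 'n::{finite,wellorder} sq_matrix" and \<sigma> :: real +
  fixes Abar :: "'n sq_matrix"
begin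

text \<open>Since \<open>k < i\<close>, the direction does not involve row \<open>i\<close>, so the
  projection is a centred Gaussian given the other rows.\<close>

lemma nn_integral_excess:
  assumes \<tau>: "0 < \<tau>" and "k < i"
  shows "(\<integral>\<^sup>+ \<omega>. ennreal (max 0 (\<bar>G \<omega> $ i \<bullet> elimination_direction (Abar + G \<omega>) k\<bar> - \<tau>)) \<partial>M)
    \<le> ennreal (2 * \<sigma> ^ 4 / \<tau>\<^sup>2 * normal_density 0 \<sigma> \<tau>)"
proof -
  define F :: "'n sq_matrix \<times> real \<Rightarrow> ennreal" where "F p = ennreal (max 0 (\<bar>snd p\<bar> - \<tau>))" for p
  have F: "F \<in> borel_measurable borel"
    unfolding F_def borel_prod[symmetric] by measurable
  have "(\<integral>\<^sup>+ \<omega>. ennreal (max 0 (\<bar>G \<omega> $ i \<bullet> elimination_direction (Abar + G \<omega>) k\<bar> - \<tau>)) \<partial>M)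
      = (\<integral>\<^sup>+ \<omega>. F (without_row i (G \<omega>),
          G \<omega> $ i \<bullet> elimination_direction (Abar + without_row i (G \<omega>)) k) \<partial>M)"
    using \<open>k < i\<close> by (simp add: F_def elimination_direction_without_row)
  also have "\<dots> = (\<integral>\<^sup>+ \<omega>. (\<integral>\<^sup>+ s. F (without_row i (G \<omega>), s) * ennreal (normal_density 0 \<sigma> s) \<partial>lborel) \<partial>M)"
    by (intro nn_integral_row_inner[where u = "\<lambda>z. elimination_direction (Abar + z) k"]
        norm_elimination_direction F) measurable
  also have "\<dots> \<le> (\<integral>\<^sup>+ \<omega>. ennreal (2 * \<sigma> ^ 4 / \<tau>\<^sup>2 * normal_density 0 \<sigma> \<tau>) \<partial>M)"
    unfolding F_def snd_conv by (intro nn_integral_mono normal_excess_bound sigma_pos \<tau>)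
  finally show ?thesis by (simp add: emeasure_space_1)
qed

text \<open>Linearity of the expectation, with the number of rows after \<open>k\<close> bounded by
  the dimension.\<close>

lemma nn_integral_numerator_bound:
  assumes \<tau>: "0 < \<tau>"
  shows "(\<integral>\<^sup>+ \<omega>. ennreal (numerator_bound Abar \<tau> k (G \<omega>)) \<partial>M)
    \<le> ennreal (1 + \<tau> + real CARD('n) * (2 * \<sigma> ^ 4 / \<tau>\<^sup>2 * normal_density 0 \<sigma> \<tau>))"
proof -
  let ?C = "2 * \<sigma> ^ 4 / \<tau>\<^sup>2 * normal_density 0 \<sigma> \<tau>"
  let ?e = "\<lambda>i \<omega>. max 0 (\<bar>G \<omega> $ i \<bullet> elimination_direction (Abar + G \<omega>) k\<bar> - \<tau>)"
  have C: "0 \<le> ?C" by simp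
  have "(\<integral>\<^sup>+ \<omega>. ennreal (numerator_bound Abar \<tau> k (G \<omega>)) \<partial>M)
      = (\<integral>\<^sup>+ \<omega>. ennreal (1 + \<tau>) + (\<Sum>i\<in>{k<..}. ennreal (?e i \<omega>)) \<partial>M)"
    unfolding numerator_bound_def using \<tau>
    by (intro nn_integral_cong, subst sum_ennreal) (auto simp: sum_nonneg simp flip: ennreal_plus)
  also have "\<dots> = ennreal (1 + \<tau>) + (\<Sum>i\<in>{k<..}. \<integral>\<^sup>+ \<omega>. ennreal (?e i \<omega>) \<partial>M)"
    by (subst nn_integral_add; simp add: nn_integral_sum emeasure_space_1)
  also have "(\<Sum>i\<in>{k<..}. \<integral>\<^sup>+ \<omega>. ennreal (?e i \<omega>) \<partial>M) \<le> (\<Sum>i\<in>{k<..}. ennreal ?C)"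
    by (intro sum_mono nn_integral_excess \<tau>) auto
  also have "\<dots> = ennreal (\<Sum>i\<in>{k<..}. ?C)"
    using C by (intro sum_ennreal) auto
  also have "(\<Sum>i\<in>{k<..}. ?C) \<le> real CARD('n) * ?C"
    unfolding sum_constant using C by (intro mult_right_mono of_nat_mono card_mono) auto
  finally show ?thesis
    using \<tau> C by (simp add: add_left_mono ennreal_leI flip: ennreal_plus)
qed

text \<open>Given the other rows, the pivot is a constant plus a Gaussian and the numerator bound is
  fixed. The small-ball estimate is linear in that bound, so only its expectation enters.\<close>

lemma prob_small_pivot:
  assumes \<tau>: "0 < \<tau>" and y: "0 < y"
  shows "prob {\<omega> \<in> space M. y * \<bar>(Abar + G \<omega>) $ k \<bullet> elimination_direction (Abar + G \<omega>) k\<bar>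
      < numerator_bound Abar \<tau> k (G \<omega>)}
    \<le> sqrt (2 / pi) / (y * \<sigma>) *
      (1 + \<tau> + real CARD('n) * (2 * \<sigma> ^ 4 / \<tau>\<^sup>2 * normal_density 0 \<sigma> \<tau>))"
    (is "prob ?E \<le> ?K * ?R")
proof -
  define F :: "'n sq_matrix \<times> real \<Rightarrow> ennreal" where
    "F p = indicator {s. y * \<bar>Abar $ k \<bullet> elimination_direction (Abar + fst p) k + s\<bar>
        < numerator_bound Abar \<tau> k (fst p)} (snd p)" for p
  have F: "F \<in> borel_measurable borel"
    unfolding F_def borel_prod[symmetric] indicator_def mem_Collect_eq by measurable
  have K: "0 \<le> ?K" using y sigma_pos by simp
  have "emeasure M ?E = (\<integral>\<^sup>+ \<omega>. indicator ?E \<omega> \<partial>M)"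
    by (subst nn_integral_indicator) auto
  also have "\<dots> = (\<integral>\<^sup>+ \<omega>. F (without_row k (G \<omega>),
        G \<omega> $ k \<bullet> elimination_direction (Abar + without_row k (G \<omega>)) k) \<partial>M)"
    by (intro nn_integral_cong)
      (simp add: F_def elimination_direction_without_row numerator_bound_without_row
        inner_add_left indicator_def)
  also have "\<dots> = (\<integral>\<^sup>+ \<omega>. (\<integral>\<^sup>+ s. F (without_row k (G \<omega>), s) * ennreal (normal_density 0 \<sigma> s) \<partial>lborel) \<partial>M)"
    by (intro nn_integral_row_inner[where u = "\<lambda>z. elimination_direction (Abar + z) k"]
        norm_elimination_direction F) measurable
  also have "\<dots> \<le> (\<integral>\<^sup>+ \<omega>. ennreal (?K * numerator_bound Abar \<tau> k (without_row k (G \<omega>))) \<partial>M)"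
    unfolding F_def fst_conv snd_conv using \<tau>
    by (intro nn_integral_mono normal_small_ball sigma_pos y less_imp_le[OF numerator_bound_pos]) auto
  also have "\<dots> = ennreal ?K * (\<integral>\<^sup>+ \<omega>. ennreal (numerator_bound Abar \<tau> k (G \<omega>)) \<partial>M)"
    unfolding numerator_bound_without_row ennreal_mult'[OF K] by (intro nn_integral_cmult) measurable
  also have "\<dots> \<le> ennreal ?K * ennreal ?R"
    by (intro mult_left_mono nn_integral_numerator_bound \<tau>) simp
  also have "\<dots> = ennreal (?K * ?R)"
    by (rule ennreal_mult'[OF K, symmetric])
  finally have "emeasure M ?E \<le> ennreal (?K * ?R)" .
  moreover have "0 \<le> ?K * ?R"
    using K \<tau> by (intro mult_nonneg_nonneg add_nonneg_nonneg) auto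
  ultimately show ?thesis by (simp only: emeasure_eq_measure ennreal_le_iff)
qed

text \<open>A union bound over the pivots: if none is small, the deterministic estimate bounds the
  growth factor.\<close>

lemma prob_growth_factor_L_gt:
  assumes Abar: "onorm (\<lambda>v. Abar *v v) \<le> 1" and \<tau>: "0 < \<tau>" and y: "1 \<le> y"
  shows "prob {\<omega> \<in> space M. ereal (real CARD('n) * y) < growth_factor_L (Abar + G \<omega>)}
    \<le> real CARD('n) * (sqrt (2 / pi) / (y * \<sigma>) *
      (1 + \<tau> + real CARD('n) * (2 * \<sigma> ^ 4 / \<tau>\<^sup>2 * normal_density 0 \<sigma> \<tau>)))"
    (is "prob ?E \<le> _ * ?R")
proof -
  define S where "S k = {\<omega> \<in> space M.
      y * \<bar>(Abar + G \<omega>) $ k \<bullet> elimination_direction (Abar + G \<omega>) k\<bar>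
      < numerator_bound Abar \<tau> k (G \<omega>)}" for k
  have [measurable]: "S k \<in> events" for k
    unfolding S_def by measurable
  have "?E \<subseteq> (\<Union>k. S k)"
  proof
    fix \<omega> assume "\<omega> \<in> ?E"
    then have "\<omega> \<in> space M" "\<not> growth_factor_L (Abar + G \<omega>) \<le> ereal (real CARD('n) * y)"
      by auto
    then obtain k where "\<not> numerator_bound Abar \<tau> k (G \<omega>)
        \<le> y * \<bar>(Abar + G \<omega>) $ k \<bullet> elimination_direction (Abar + G \<omega>) k\<bar>"
      using growth_factor_L_le_if_pivots[OF Abar less_imp_le[OF \<tau>] y, of "G \<omega>"] by blast
    then show "\<omega> \<in> (\<Union>k. S k)"
      using \<open>\<omega> \<in> space M\<close> unfolding S_def by (auto simp: not_le)
  qed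
  then have "prob ?E \<le> prob (\<Union>k. S k)"
    by (intro finite_measure_mono) auto
  also have "\<dots> \<le> (\<Sum>k\<in>UNIV. prob (S k))"
    by (intro finite_measure_subadditive_finite) auto
  also have "\<dots> \<le> (\<Sum>k\<in>(UNIV :: 'n set). ?R)"
    unfolding S_def using y by (intro sum_mono prob_small_pivot \<tau>) auto
  finally show ?thesis by simp
qed

end

section \<open>Choice of the threshold and the final estimate\<close>

theorem theorem4p4:
  fixes M :: "'w measure" and Abar :: "'n::{finite,wellorder} sq_matrix"
    and A :: "'w \<Rightarrow> 'n sq_matrix" and n :: nat and \<sigma> x :: real
  assumes "prob_space M"
    and "n = CARD('n)" and "n \<ge> 2"
    and "onorm (\<lambda>v. Abar *v v) \<le> 1"
    and "\<sigma> > 0" and "\<sigma>\<^sup>2 \<le> 1"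
    and "gaussian_perturbation M \<sigma> Abar A"
    and "x > 0"
  shows "measure M {\<omega> \<in> space M. growth_factor_L (A \<omega>) > ereal x}
    \<le> sqrt (2 / pi) * ((real n)\<^sup>2 / x) *
        (sqrt 2 / \<sigma> + sqrt (2 * ln (real n)) + 1 / (sqrt (2 * pi) * ln (real n)))"
    (is "measure M ?E \<le> ?B * (sqrt 2 / \<sigma> + ?t + ?r)")
proof -
  interpret prob_space M by fact
  obtain G where A: "\<And>\<omega>. \<omega> \<in> space M \<Longrightarrow> A \<omega> = Abar + G \<omega>"
    and G: "indep_vars (\<lambda>_. borel) (\<lambda>(i, j) \<omega>. G \<omega> $ i $ j) UNIV"
      "\<And>i j. distributed M lborel (\<lambda>\<omega>. G \<omega> $ i $ j) (normal_density 0 \<sigma>)"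
    using assms(7) unfolding gaussian_perturbation_def by blast
  interpret perturbed_square_matrix M G \<sigma> Abar
    by unfold_locales (use G assms in auto)
  have \<sigma>: "0 < \<sigma>" "\<sigma> \<le> 1" and n: "2 \<le> real n" and x: "0 < x"
    using assms by (auto simp: power2_le_iff_abs_le power_le_one_iff abs_square_le_1)
  have ln: "0 < ln (real n)" and t: "0 < ?t" and r: "0 < ?r"
    using n by auto
  have B: "0 < ?B" using n x by simp
  \<comment> \<open>The union bound requires \<open>y = x / n\<close> to be at least 1. For smaller
    \<open>x\<close> the right-hand side is at least 1 and the claim is trivial.\<close>
  show ?thesis
  proof (cases "real n \<le> x")
    case True
    define y where "y = x / real n"
    have y: "1 \<le> y" and ny: "real n * y = x"
      using True n by (auto simp: y_def)
    have "measure M ?E = prob {\<omega> \<in> space M. ereal (real CARD('n) * y) < growth_factor_L (Abar + G \<omega>)}"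
      using ny A by (intro arg_cong[where f = prob]) (auto simp: assms(2))
    \<comment> \<open>The threshold \<open>\<sigma> * sqrt (2 * ln n)\<close> makes the density
      there \<open>1 / (sqrt (2 * pi) * \<sigma> * n)\<close>, which cancels the factor
      \<open>n\<close> from summing the excesses.\<close>
    also have "\<dots> \<le> real n * (sqrt (2 / pi) / (y * \<sigma>) *
        (1 + \<sigma> * ?t + real n * (2 * \<sigma> ^ 4 / (\<sigma> * ?t)\<^sup>2 * normal_density 0 \<sigma> (\<sigma> * ?t))))"
      using prob_growth_factor_L_gt[OF assms(4) _ y, of "\<sigma> * ?t"] \<sigma> t by (simp add: assms(2))
    also have "real n * (2 * \<sigma> ^ 4 / (\<sigma> * ?t)\<^sup>2 * normal_density 0 \<sigma> (\<sigma> * ?t)) = \<sigma> * ?r"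
    proof -
      have "normal_density 0 \<sigma> (\<sigma> * ?t) = 1 / (sqrt (2 * pi) * \<sigma>) * exp (- ln (real n))"
        using \<sigma> ln by (simp add: normal_density_def power_mult_distrib real_sqrt_mult)
      then have "normal_density 0 \<sigma> (\<sigma> * ?t) = 1 / (sqrt (2 * pi) * \<sigma> * real n)"
        using n by (simp add: exp_minus field_simps)
      moreover have "2 * \<sigma> ^ 4 / (\<sigma> * ?t)\<^sup>2 = \<sigma>\<^sup>2 / ln (real n)"
        using \<sigma> ln by (simp add: power_mult_distrib field_simps power2_eq_square power4_eq_xxxx)
      ultimately show ?thesis
        using \<sigma> n ln by (simp add: field_simps power2_eq_square)
    qed
    also have "real n * (sqrt (2 / pi) / (y * \<sigma>) * (1 + \<sigma> * ?t + \<sigma> * ?r)) = ?B * (1 / \<sigma> + ?t + ?r)"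
    proof -
      have "real n * (c / (y * \<sigma>) * (1 + \<sigma> * t + \<sigma> * r)) = c * ((real n)\<^sup>2 / x) * (1 / \<sigma> + t + r)"
        for c t r :: real
      proof -
        have "1 / (y * \<sigma>) * (1 + \<sigma> * t + \<sigma> * r) = 1 / y * (1 / \<sigma> + t + r)"
          using \<sigma> by (simp add: field_simps)
        moreover have "real n * (1 / y) = (real n)\<^sup>2 / x"
          by (simp add: y_def power2_eq_square)
        ultimately show ?thesis
          by (metis (no_types, opaque_lifting) mult.assoc mult.left_commute mult_1_right times_divide_eq_right)
      qed
      then show ?thesis .
    qed
    also have "\<dots> \<le> ?B * (sqrt 2 / \<sigma> + ?t + ?r)"
      using \<sigma> B by (intro mult_left_mono add_right_mono divide_right_mono) auto
    finally show ?thesis .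
  next
    case False
    \<comment> \<open>Three factors give the lower bound 1: \<open>pi < 4\<close> here, then
      \<open>x < n\<close> with \<open>n\<close> at most its square, and
      \<open>\<sigma> \<le> 1\<close> for the term \<open>sqrt 2 / \<sigma>\<close>.\<close>
    have "sqrt (2 / pi) * sqrt 2 = 2 / sqrt pi"
      by (simp add: real_sqrt_divide)
    also have "1 \<le> 2 / sqrt pi"
      using pi_less_4 real_sqrt_le_mono[of pi 4] by simp
    finally have "1 \<le> sqrt (2 / pi) * sqrt 2" .
    moreover have "x \<le> (real n)\<^sup>2"
      using False n self_le_power[of "real n" 2] by linarith
    then have "1 \<le> (real n)\<^sup>2 / x"
      using x by simp
    moreover have "sqrt 2 \<le> sqrt 2 / \<sigma> + ?t + ?r"
    proof -
      have "sqrt 2 \<le> sqrt 2 / \<sigma>" using \<sigma> by (simp add: pos_le_divide_eq)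
      then show ?thesis using t r by linarith
    qed
    ultimately have "1 \<le> ?B * (sqrt 2 / \<sigma> + ?t + ?r)"
    proof -
      assume a: "1 \<le> sqrt (2 / pi) * sqrt 2" "1 \<le> (real n)\<^sup>2 / x"
        "sqrt 2 \<le> sqrt 2 / \<sigma> + ?t + ?r"
      have "1 \<le> (sqrt (2 / pi) * sqrt 2) * ((real n)\<^sup>2 / x)"
        using mult_mono[OF a(1,2)] by simp
      also have "\<dots> = ?B * sqrt 2" by (simp only: mult.assoc mult.commute mult.left_commute)
      also have "\<dots> \<le> ?B * (sqrt 2 / \<sigma> + ?t + ?r)"
        using a(3) B by (intro mult_left_mono) auto
      finally show ?thesis .
    qed
    then show ?thesis using prob_le_1[of ?E] by linarith
  qed
qed

end
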